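(* For any integer $n\ge1$, the worst-case expected social benefit rate $Z_s(n)=\inf_{\mathbb P\in\mathcal P}\mathbb E_{\mathbb P}[f_n(\tilde\rho)]$ coincides with the optimal value of the following semidefinite program: maximize (take the supremum of) $\alpha d+\beta m+\gamma$ over $\alpha,\beta,\gamma\in\mathbb R$, vectors $y=(y_0,\dots,y_{n+3})$, $z=(z_0,\dots,z_{n+3})\in\mathbb R^{n+4}$ and positive semidefinite matrices $X=[x_{ij}]_{i,j=0}^{n+3}$, $X'=[x'_{ij}]_{i,j=0}^{n+3}\in\mathbb S_+^{n+4}$, subject to: (i) $y_0=-(\alpha m+\gamma)$, $y_{n+3}=\alpha-\beta$, $y_1=R\mu-C-y_0+y_{n+3}$, $y_2=-R\mu-y_{n+3}$, $y_3=\dots=y_n=0$, $y_{n+1}=-R\mu+C(n+1)-y_0$, $y_{n+2}=R\mu-Cn+y_0-y_{n+3}$; (ii) $\sum_{i+j=2l-1}x_{ij}=0$ for $l=1,\dots,n+3$, and for $l=0,\dots,n+3$, $$\sum_{i+j=2l}x_{ij}=\sum_{q=0}^{l}\sum_{r=q}^{n+3+q-l}y_r\binom rq\binom{n+3-r}{l-q}a^{r-q}m^q;$$ (iii) $z_0=\alpha m-\gamma$, $z_{n+3}=-(\alpha+\beta)$, $z_1=R\mu-C-z_0+z_{n+3}$, $z_2=-R\mu-z_{n+3}$, $z_3=\dots=z_n=0$, $z_{n+1}=-R\mu+C(n+1)-z_0$, $z_{n+2}=R\mu-Cn+z_0-z_{n+3}$; (iv) $\sum_{i+j=2l-1}x'_{ij}=0$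 for $l=1,\dots,n+3$, and for $l=0,\dots,n+3$, $$\sum_{i+j=2l}x'_{ij}=\sum_{q=0}^{l}\sum_{r=q}^{n+3+q-l}z_r\binom rq\binom{n+3-r}{l-q}m^{r-q}b^q.$$ The conditions $y_3=\dots=y_n=0$ and $z_3=\dots=z_n=0$ are vacuous for $n\le2$; for $n=1$, where the indices $2$ and $n+1$ coincide, $y_2$ (resp. $z_2$) is required to equal the sum of the two right-hand sides given for $y_2$ and $y_{n+1}$ (resp. $z_2$ and $z_{n+1}$).
   Context: $R,C,\mu>0$ are fixed real constants. For an integer $n\ge0$, $f_n:[0,\infty)\to\mathbb R$ is $$f_n(\rho)=R\mu\,\frac{\rho(1-\rho^n)}{1-\rho^{n+1}}-C\left(\frac{\rho}{1-\rho}-\frac{(n+1)\rho^{n+1}}{1-\rho^{n+1}}\right)\ (\rho\ne1),\qquad f_n(1)=R\mu\,\frac{n}{n+1}-C\,\frac n2 .$$ Real numbers $0\le a<b$, $m\in(a,b)$ and $d\in(0,\overline d)$ with $\overline d=\frac{2(m-a)(b-m)}{b-a}$ are given. The mean-absolute-deviation (MAD) ambiguity set is $$\mathcal P=\{\mathbb P \text{ a Borel probability measure on }[a,b]:\ \mathbb E_{\mathbb P}[\tilde\rho]=m,\ \mathbb E_{\mathbb P}[|\tilde\rho-m|]=d\}.$$ $\mathbb S_+^k$ denotes the cone of $k\times k$ real symmetric positive semidefinite matrices. Sums over $i+j=s$ run over pairs of indices $i,j\in\{0,\dots,n+3\}$. Convention $0^0=1$. *)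

theory Defs
  imports "HOL-Probability.Probability" "Jordan_Normal_Form.Matrix"
begin

no_notation vec_nth (infixl \<open>$\<close> 90)

text \<open>Only the values for \<open>\<rho> \<ge> 0\<close> are meaningful; there \<open>\<rho> ^ (n + 1) = 1\<close> holds for \<open>\<rho> = 1\<close> only,
  so no denominator vanishes.\<close>

definition social_benefit :: "real \<Rightarrow> real \<Rightarrow> real \<Rightarrow> nat \<Rightarrow> real \<Rightarrow> real" where
  "social_benefit R C \<mu> n \<rho> =
     (if \<rho> = 1 then R * \<mu> * (real n / real (n + 1)) - C * (real n / 2)
      else R * \<mu> * (\<rho> * (1 - \<rho> ^ n) / (1 - \<rho> ^ (n + 1)))
           - C * (\<rho> / (1 - \<rho>) - real (n + 1) * \<rho> ^ (n + 1) / (1 - \<rho> ^ (n + 1))))"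

definition mad_ambiguity_set :: "real \<Rightarrow> real \<Rightarrow> real \<Rightarrow> real \<Rightarrow> real measure set" where
  "mad_ambiguity_set a b m d =
     {P. prob_space P \<and> sets P = sets (restrict_space borel {a..b}) \<and>
         prob_space.expectation P (\<lambda>\<rho>. \<rho>) = m \<and>
         prob_space.expectation P (\<lambda>\<rho>. \<bar>\<rho> - m\<bar>) = d}"

text \<open>Optimal values are taken in the extended reals, so that the infimum and the supremum below
  never depend on the unspecified values of \<^const>\<open>Inf\<close> and \<^const>\<open>Sup\<close> on the reals.\<close>

definition worst_case_benefit ::
    "real \<Rightarrow> real \<Rightarrow> real \<Rightarrow> real \<Rightarrow> real \<Rightarrow> real \<Rightarrow> real \<Rightarrow> nat \<Rightarrow> ereal" where
  "worst_case_benefit R C \<mu> a b m d n =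
     (INF P \<in> mad_ambiguity_set a b m d.
        ereal (prob_space.expectation P (social_benefit R C \<mu> n)))"

definition psd_cone :: "nat \<Rightarrow> real mat set" where
  "psd_cone k =
     {X \<in> carrier_mat k k. transpose_mat X = X \<and>
        (\<forall>v \<in> carrier_vec k. 0 \<le> scalar_prod v (X *\<^sub>v v))}"

text \<open>With \<open>y $ 0 + y $ (n + 3) * \<rho>\<close> the negative of an affine function, the entries of \<open>y\<close> are the
  coefficients of (\<open>social_benefit\<close> minus that affine function) times \<open>(1 - \<rho>) * (1 - \<rho> ^ (n + 1))\<close>.
  The indices \<open>2\<close> and \<open>n + 1\<close> coincide for \<open>n = 1\<close>, and
  the two prescribed values are then added.\<close>

definition coefficient_constraints ::
    "real \<Rightarrow> real \<Rightarrow> real \<Rightarrow> nat \<Rightarrow> real vec \<Rightarrow> bool" where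
  "coefficient_constraints R C \<mu> n y \<longleftrightarrow>
     y $ 1 = R * \<mu> - C - y $ 0 + y $ (n + 3) \<and>
     (if n = 1
      then y $ 2 = (- (R * \<mu>) - y $ (n + 3)) + (- (R * \<mu>) + C * real (n + 1) - y $ 0)
      else y $ 2 = - (R * \<mu>) - y $ (n + 3) \<and>
           y $ (n + 1) = - (R * \<mu>) + C * real (n + 1) - y $ 0) \<and>
     (\<forall>r \<in> {3..n}. y $ r = 0) \<and>
     y $ (n + 2) = R * \<mu> - C * real n + y $ 0 - y $ (n + 3)"

definition antidiagonal_sum :: "nat \<Rightarrow> real mat \<Rightarrow> nat \<Rightarrow> real" where
  "antidiagonal_sum k X s = (\<Sum>(i, j) \<in> {(i, j). i < k \<and> j < k \<and> i + j = s}. X $$ (i, j))"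

text \<open>The right-hand side is the coefficient of \<open>t ^ (2 * l)\<close> in
  \<open>(1 + t\<^sup>2) ^ (n + 3) * p ((lo + hi * t\<^sup>2) / (1 + t\<^sup>2))\<close>, where \<open>p\<close> is the polynomial with
  coefficients \<open>y\<close>. All subtractions of naturals are exact on the ranges of summation.\<close>

definition interval_constraints ::
    "nat \<Rightarrow> real \<Rightarrow> real \<Rightarrow> real vec \<Rightarrow> real mat \<Rightarrow> bool" where
  "interval_constraints n lo hi y X \<longleftrightarrow>
     (\<forall>l \<in> {1..n + 3}. antidiagonal_sum (n + 4) X (2 * l - 1) = 0) \<and>
     (\<forall>l \<in> {0..n + 3}. antidiagonal_sum (n + 4) X (2 * l) =
        (\<Sum>q = 0..l. \<Sum>r = q..n + 3 + q - l.
           y $ r * real (r choose q) * real ((n + 3 - r) choose (l - q)) * lo ^ (r - q) * hi ^ q))"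

definition sdp_feasible ::
    "real \<Rightarrow> real \<Rightarrow> real \<Rightarrow> real \<Rightarrow> real \<Rightarrow> real \<Rightarrow> nat \<Rightarrow>
     real \<Rightarrow> real \<Rightarrow> real \<Rightarrow> real vec \<Rightarrow> real vec \<Rightarrow> real mat \<Rightarrow> real mat \<Rightarrow> bool" where
  "sdp_feasible R C \<mu> a b m n \<alpha> \<beta> \<gamma> y z X X' \<longleftrightarrow>
     y \<in> carrier_vec (n + 4) \<and> z \<in> carrier_vec (n + 4) \<and>
     X \<in> psd_cone (n + 4) \<and> X' \<in> psd_cone (n + 4) \<and>
     y $ 0 = - (\<alpha> * m + \<gamma>) \<and> y $ (n + 3) = \<alpha> - \<beta> \<and> coefficient_constraints R C \<mu> n y \<and>
     interval_constraints n a m y X \<and>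
     z $ 0 = \<alpha> * m - \<gamma> \<and> z $ (n + 3) = - (\<alpha> + \<beta>) \<and> coefficient_constraints R C \<mu> n z \<and>
     interval_constraints n m b z X'"

definition sdp_value ::
    "real \<Rightarrow> real \<Rightarrow> real \<Rightarrow> real \<Rightarrow> real \<Rightarrow> real \<Rightarrow> real \<Rightarrow> nat \<Rightarrow> ereal" where
  "sdp_value R C \<mu> a b m d n =
     Sup {ereal (\<alpha> * d + \<beta> * m + \<gamma>) | \<alpha> \<beta> \<gamma> y z X X'. sdp_feasible R C \<mu> a b m n \<alpha> \<beta> \<gamma> y z X X'}"

end

theory Submission
  imports Defs
begin

text \<open>The dual of the moment problem maximizes \<open>\<alpha> * d + \<beta> * m + \<gamma>\<close> over the functions
  \<open>\<alpha> * \<bar>\<rho> - m\<bar> + \<beta> * \<rho> + \<gamma>\<close> below the social benefit on \<open>[a, b]\<close>. There is no duality gap, by separation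
  from the convex hull of the moment curve. Such a minorant is affine on \<open>[a, m]\<close> and on \<open>[m, b]\<close>, so
  multiplying by \<open>(1 - \<rho>) * (1 - \<rho> ^ (n + 1))\<close> turns the constraint into nonnegativity of one polynomial on
  each interval. A Moebius substitution moves the interval to the real line, where a nonnegative
  polynomial is a sum of squares, that is, has a positive semidefinite Gram matrix.\<close>

section \<open>Sums of squares and Gram matrices\<close>

text \<open>The absolute value of a nonconstant polynomial tends to infinity, so by nonnegativity
  only a compact ball can contain values below \<open>poly p 0\<close>; the minimum over that ball
  is global.\<close>

lemma nonneg_poly_attains_min:
  fixes p :: "real poly"
  assumes "\<And>x. 0 \<le> poly p x" "degree p > 0"
  shows "\<exists>x0. \<forall>x. poly p x0 \<le> poly p x"
proof -
  have "filterlim (\<lambda>x. norm (poly p x)) at_top at_infinity"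
    using assms(2) by (intro filterlim_at_infinity_imp_norm_at_top filterlim_poly_at_infinity)
  then have "eventually (\<lambda>x. norm (poly p x) \<ge> poly p 0) at_infinity"
    by (simp add: filterlim_at_top)
  then obtain B where B: "\<And>x. norm x \<ge> B \<Longrightarrow> poly p 0 \<le> poly p x"
    using assms(1) by (auto simp: eventually_at_infinity)
  \<comment> \<open>The radius \<open>\<bar>B\<bar>\<close> puts 0 in the ball even for negative
    \<open>B\<close>; the minimum on the ball is then at most \<open>poly p 0\<close>, a lower bound
    for the values outside.\<close>
  obtain x0 where x0: "x0 \<in> cball 0 \<bar>B\<bar>" "\<And>x. x \<in> cball 0 \<bar>B\<bar> \<Longrightarrow> poly p x0 \<le> poly p x"
    using continuous_attains_inf[of "cball (0::real) \<bar>B\<bar>" "poly p"]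
    by (fastforce intro: continuous_intros)
  have "poly p x0 \<le> poly p x" for x
  proof (cases "x \<in> cball 0 \<bar>B\<bar>")
    case False
    then have "poly p 0 \<le> poly p x" by (intro B) auto
    with x0(2)[of 0] show ?thesis by simp
  qed (use x0 in auto)
  then show ?thesis by blast
qed

text \<open>A simple root would force a sign change: after one factor is split off, the cofactor is
  nonnegative right of \<open>c\<close> and nonpositive left of it, hence zero at \<open>c\<close>
  by continuity.\<close>

lemma nonneg_poly_double_root:
  fixes p :: "real poly"
  assumes nonneg: "\<And>x. 0 \<le> poly p x" and "poly p c = 0"
  obtains q where "p = [:-c, 1:]\<^sup>2 * q" "\<And>x. 0 \<le> poly q x"
proof -
  obtain r where r: "p = [:-c, 1:] * r"
    using assms(2) by (auto simp: poly_eq_0_iff_dvd elim: dvdE)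
  have "poly r c \<ge> 0"
  proof -
    have "0 \<le> poly r x" if "x \<in> {c<..}" for x
      using nonneg[of x] that by (simp only: r poly_mult) (simp add: zero_le_mult_iff)
    then show ?thesis
      by (rule continuous_ge_on_closure[of "{c<..}" "poly r" c 0, rotated 2])
        (auto intro: continuous_intros)
  qed
  moreover have "poly r c \<le> 0"
  proof -
    have "poly r x \<le> 0" if "x \<in> {..<c}" for x
      using nonneg[of x] that by (simp only: r poly_mult) (simp add: zero_le_mult_iff)
    then show ?thesis
      by (rule continuous_le_on_closure[of "{..<c}" "poly r" c 0, rotated 2])
        (auto intro: continuous_intros)
  qed
  ultimately obtain q where q: "r = [:-c, 1:] * q"
    by (metis antisym poly_eq_0_iff_dvd dvdE)
  have p: "p = [:-c, 1:]\<^sup>2 * q"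
    by (simp only: r q power2_eq_square mult.assoc)
  have off: "0 \<le> poly q x" if "x \<noteq> c" for x
  proof -
    have "0 \<le> (x - c)\<^sup>2 * poly q x"
      using nonneg[of x] unfolding p by (simp add: poly_power)
    then show ?thesis using that by (simp add: zero_le_mult_iff)
  qed
  have "0 \<le> poly q c"
    using off by (intro continuous_ge_on_closure[of "{c<..}" "poly q" c 0])
      (auto intro: continuous_intros)
  with off have "\<And>x. 0 \<le> poly q x" by metis
  with p show thesis by (rule that)
qed

text \<open>Subtracting the minimum value creates a double root, which splits off a square. This avoids the
  fundamental theorem of algebra.\<close>

lemma nonneg_poly_sum_of_squares:
  fixes p :: "real poly"
  assumes "\<And>x. 0 \<le> poly p x"
  shows "\<exists>qs. p = (\<Sum>q\<leftarrow>qs. q\<^sup>2) \<and> (\<forall>q\<in>set qs. 2 * degree q \<le> degree p)"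
  using assms
proof (induction "degree p" arbitrary: p rule: less_induct)
  case less
  show ?case
  proof (cases "degree p = 0")
    case True
    then obtain c where c: "p = [:c:]" by (auto elim: degree_eq_zeroE)
    with less.prems[of 0] have "p = (\<Sum>q\<leftarrow>[[:sqrt c:]]. q\<^sup>2)"
      by (simp add: power2_eq_square)
    with c show ?thesis by (intro exI[of _ "[[:sqrt c:]]"]) auto
  next
    case False
    then obtain x0 where x0: "\<And>x. poly p x0 \<le> poly p x"
      using nonneg_poly_attains_min[of p] less.prems by blast
    define c where "c = poly p x0"
    have "0 \<le> poly (p - [:c:]) x" "poly (p - [:c:]) x0 = 0" for x
      using x0 by (auto simp: c_def)
    then obtain q where q: "p - [:c:] = [:-x0, 1:]\<^sup>2 * q" and q0: "\<And>x. 0 \<le> poly q x"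
      using nonneg_poly_double_root[of "p - [:c:]" x0] by metis
    have "degree (p - [:c:]) = degree p"
      using False by (metis degree_pCons_0 degree_minus degree_add_eq_left diff_conv_add_uminus neq0_conv)
    moreover have "q \<noteq> 0"
      using q False by (metis calculation degree_0 mult_zero_right)
    ultimately have deg: "degree p = 2 + degree q"
      unfolding q by (simp add: degree_mult_eq degree_power_eq)
    obtain qs where qs: "q = (\<Sum>r\<leftarrow>qs. r\<^sup>2)" "\<And>r. r \<in> set qs \<Longrightarrow> 2 * degree r \<le> degree q"
      using less.hyps[of q] q0 deg by auto
    have "p = [:-x0, 1:]\<^sup>2 * q + [:c:]"
      using q by (simp add: algebra_simps)
    \<comment> \<open>The minimum value \<open>c\<close> is nonnegative, hence the square of
      \<open>sqrt c\<close>; the squared factor \<open>[:-x0, 1:]\<close> is absorbed into each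
      square from \<open>qs\<close>.\<close>
    also have "\<dots> = (\<Sum>r\<leftarrow>[:sqrt c:] # map ((*) [:-x0, 1:]) qs. r\<^sup>2)"
      using less.prems[of x0] unfolding qs(1)
      by (simp add: c_def sum_list_const_mult[symmetric] o_def power_mult_distrib
          power2_eq_square[of "[:sqrt _:]"] del: mult_pCons_left)
    finally have "p = (\<Sum>r\<leftarrow>[:sqrt c:] # map ((*) [:-x0, 1:]) qs. r\<^sup>2)" .
    moreover have "2 * degree r \<le> degree p" if "r \<in> set ([:sqrt c:] # map ((*) [:-x0, 1:]) qs)" for r
    proof -
      from that consider "r = [:sqrt c:]" | q' where "q' \<in> set qs" "r = [:-x0, 1:] * q'"
        by auto
      then show ?thesis
      proof cases
        case 2
        have "degree r \<le> 1 + degree q'"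
          unfolding 2(2) using degree_mult_le[of "[:-x0, 1:]" q'] by simp
        with qs(2)[OF 2(1)] deg show ?thesis by linarith
      qed simp
    qed
    ultimately show ?thesis by blast
  qed
qed

text \<open>The matrix is a sum of rank-one matrices formed from coefficient vectors, so its
  quadratic form is a sum of squares.\<close>

lemma psd_cone_Gram:
  fixes qs :: "real poly list" and k :: nat
  defines "X \<equiv> mat k k (\<lambda>(i, j). \<Sum>q\<leftarrow>qs. coeff q i * coeff q j)"
  shows "X \<in> psd_cone k"
proof -
  have X: "X \<in> carrier_mat k k" by (simp add: X_def)
  have "0 \<le> scalar_prod v (X *\<^sub>v v)" if v: "v \<in> carrier_vec k" for v
  proof -
    have "scalar_prod v (X *\<^sub>v v) = (\<Sum>i<k. \<Sum>j<k. \<Sum>q\<leftarrow>qs. (coeff q i * v $ i) * (coeff q j * v $ j))"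
      using v X unfolding scalar_prod_def
      by (auto simp: X_def scalar_prod_def sum_distrib_left lessThan_atLeast0
          sum_list_const_mult[symmetric] mult_ac intro!: sum.cong)
    also have "\<dots> = (\<Sum>q\<leftarrow>qs. (\<Sum>i<k. coeff q i * v $ i)\<^sup>2)"
      by (induction qs) (simp_all add: sum.distrib sum_product power2_eq_square)
    also have "\<dots> \<ge> 0"
      by (intro sum_list_nonneg) auto
    finally show ?thesis .
  qed
  then show ?thesis
    using X by (auto simp: psd_cone_def X_def mult.commute intro!: eq_matI)
qed

text \<open>Entries on one antidiagonal add up to the Cauchy product of coefficients. By the degree
  bound, cutting off at size \<open>k\<close> loses only zero terms.\<close>

lemma antidiagonal_sum_Gram:
  fixes qs :: "real poly list" and k :: nat
  assumes "\<And>q. q \<in> set qs \<Longrightarrow> degree q < k"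
  shows "antidiagonal_sum k (mat k k (\<lambda>(i, j). \<Sum>q\<leftarrow>qs. coeff q i * coeff q j)) s
       = coeff (\<Sum>q\<leftarrow>qs. q\<^sup>2) s" (is "antidiagonal_sum k ?X s = _")
proof -
  let ?D = "{(i, j). i < k \<and> j < k \<and> i + j = s}"
  have fin: "finite ?D" by (rule finite_subset[of _ "{..<k} \<times> {..<k}"]) auto
  have sq: "(\<Sum>(i, j)\<in>?D. coeff q i * coeff q j) = coeff (q\<^sup>2) s" if "degree q < k" for q :: "real poly"
  proof -
    have "coeff (q\<^sup>2) s = (\<Sum>(i, j)\<in>{(i, j). i + j = s}. coeff q i * coeff q j)"
      unfolding power2_eq_square coeff_mult
      by (rule sum.reindex_bij_witness[of _ fst "\<lambda>i. (i, s - i)"]) auto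
    also have "\<dots> = (\<Sum>(i, j)\<in>?D. coeff q i * coeff q j)"
    proof (rule sum.mono_neutral_right)
      show "finite {(i, j). i + j = s}"
        by (rule finite_subset[of _ "{..s} \<times> {..s}"]) auto
    qed (use that in \<open>auto dest!: le_degree\<close>)
    finally show ?thesis by simp
  qed
  have "antidiagonal_sum k ?X s = (\<Sum>(i, j)\<in>?D. \<Sum>q\<leftarrow>qs. coeff q i * coeff q j)"
    unfolding antidiagonal_sum_def by (intro sum.cong) auto
  also have "\<dots> = (\<Sum>q\<leftarrow>qs. coeff (q\<^sup>2) s)"
    using assms by (induction qs) (simp_all add: split_def sum.distrib sq[unfolded split_def])
  also have "\<dots> = coeff (\<Sum>q\<leftarrow>qs. q\<^sup>2) s"
    by (induction qs) simp_all
  finally show ?thesis .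
qed

text \<open>The quadratic form is evaluated at the vector of powers of \<open>t\<close>, and its
  terms are grouped by \<open>i + j\<close>, whose largest value is
  \<open>2 * k - 2\<close>.\<close>

lemma psd_cone_antidiagonal_sums_nonneg:
  assumes "X \<in> psd_cone k"
  shows "0 \<le> (\<Sum>s<2 * k - 1. antidiagonal_sum k X s * t ^ s)"
proof -
  let ?v = "vec k (\<lambda>i. t ^ i)"
  have X: "X \<in> carrier_mat k k" using assms by (simp add: psd_cone_def)
  have "0 \<le> scalar_prod ?v (X *\<^sub>v ?v)"
    using assms by (simp add: psd_cone_def)
  also have "\<dots> = (\<Sum>i<k. \<Sum>j<k. X $$ (i, j) * t ^ (i + j))"
    using X by (auto simp: scalar_prod_def sum_distrib_left lessThan_atLeast0 power_add mult_ac
        intro!: sum.cong)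
  also have "\<dots> = (\<Sum>p\<in>{..<k} \<times> {..<k}. X $$ p * t ^ (fst p + snd p))"
    by (simp add: sum.cartesian_product split_def)
  also have "\<dots> = (\<Sum>s<2 * k - 1. \<Sum>p\<in>{p \<in> {..<k} \<times> {..<k}. fst p + snd p = s}. X $$ p * t ^ (fst p + snd p))"
    by (rule sum.group[symmetric]) auto
  also have "\<dots> = (\<Sum>s<2 * k - 1. antidiagonal_sum k X s * t ^ s)"
    unfolding antidiagonal_sum_def sum_distrib_right
    by (intro sum.cong refl) (auto intro!: sum.cong)
  finally show ?thesis .
qed

section \<open>Nonnegativity on an interval\<close>

lemma coeff_pcompose_monom_2:
  fixes p :: "'a::comm_semiring_1 poly"
  shows "coeff (pcompose p (monom 1 2)) k = (if even k then coeff p (k div 2) else 0)"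
proof (induction p arbitrary: k)
  case (pCons a p)
  have "even k \<Longrightarrow> k \<noteq> 0 \<Longrightarrow> k \<ge> 2 \<and> k div 2 = Suc ((k - 2) div 2)"
    by (auto elim!: evenE)
  with pCons.IH[of "k - 2"] show ?case
    by (auto simp: pcompose_pCons coeff_monom_mult coeff_pCons split: nat.splits)
qed simp

lemma coeff_linear_poly_power':
  fixes a b :: "'a::comm_semiring_1"
  shows "coeff ([:a, b:] ^ n) i = of_nat (n choose i) * b ^ i * a ^ (n - i)"
proof (cases "i \<le> n")
  case False
  have "degree ([:a, b:] ^ n) \<le> degree [:a, b:] * n" by (rule degree_power_le)
  also have "\<dots> \<le> n" by simp
  finally show ?thesis using False by (simp add: coeff_eq_0 binomial_eq_0)
qed (rule coeff_linear_poly_power)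

text \<open>The substitution \<open>x = (lo + hi * t\<^sup>2) / (1 + t\<^sup>2)\<close> maps the real line onto \<open>[lo, hi)\<close>; clearing
  denominators turns a polynomial of degree at most \<open>N\<close> in \<open>x\<close> into an even one in \<open>t\<close>.\<close>

definition moebius_poly :: "nat \<Rightarrow> real \<Rightarrow> real \<Rightarrow> (nat \<Rightarrow> real) \<Rightarrow> real poly" where
  "moebius_poly N lo hi y =
     pcompose (\<Sum>r\<le>N. Polynomial.smult (y r) ([:lo, hi:] ^ r * [:1, 1:] ^ (N - r))) (monom 1 2)"

lemma poly_moebius_poly:
  "poly (moebius_poly N lo hi y) t =
     (1 + t\<^sup>2) ^ N * (\<Sum>r\<le>N. y r * ((lo + hi * t\<^sup>2) / (1 + t\<^sup>2)) ^ r)"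
proof -
  have nz: "1 + t\<^sup>2 \<noteq> 0" by (simp add: add_nonneg_eq_0_iff)
  have eq: "(1 + t\<^sup>2) ^ N * (y r * ((lo + hi * t\<^sup>2) / (1 + t\<^sup>2)) ^ r) =
      y r * ((lo + hi * t\<^sup>2) ^ r * (1 + t\<^sup>2) ^ (N - r))" if "r \<le> N" for r
    using nz that by (simp add: power_divide power_diff)
  have "poly (moebius_poly N lo hi y) t = (\<Sum>r\<le>N. y r * ((lo + hi * t\<^sup>2) ^ r * (1 + t\<^sup>2) ^ (N - r)))"
    by (simp add: moebius_poly_def poly_pcompose poly_monom poly_sum mult.commute[of hi])
  also have "\<dots> = (\<Sum>r\<le>N. (1 + t\<^sup>2) ^ N * (y r * ((lo + hi * t\<^sup>2) / (1 + t\<^sup>2)) ^ r))"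
    by (rule sum.cong) (simp_all only: eq atMost_iff)
  finally show ?thesis by (simp only: sum_distrib_left)
qed

lemma degree_moebius_poly: "degree (moebius_poly N lo hi y) \<le> 2 * N"
proof -
  have "degree ([:lo, hi:] ^ r * [:1, 1:] ^ (N - r)) \<le> N" if "r \<le> N" for r
  proof -
    have "degree ([:lo, hi:] ^ r * [:1, 1:] ^ (N - r)) \<le>
        degree [:lo, hi:] * r + degree [:1, 1::real:] * (N - r)"
      by (intro order.trans[OF degree_mult_le] add_mono degree_power_le)
    also have "\<dots> \<le> 1 * r + 1 * (N - r)"
      by (intro add_mono mult_right_mono) auto
    finally show ?thesis using that by simp
  qed
  then have "degree (\<Sum>r\<le>N. Polynomial.smult (y r) ([:lo, hi:] ^ r * [:1, 1:] ^ (N - r))) \<le> N"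
    by (intro degree_sum_le) (auto intro: order.trans[OF degree_smult_le])
  then show ?thesis
    by (auto simp: moebius_poly_def degree_monom_eq mult.commute intro!: order.trans[OF degree_pcompose_le])
qed

text \<open>Expanding both binomial powers gives a sum over all \<open>r \<le> N\<close>; the
  narrower range drops only terms with \<open>r < q\<close> or \<open>N - r < l - q\<close>, where a
  binomial coefficient is zero.\<close>

lemma coeff_moebius_poly:
  "coeff (moebius_poly N lo hi y) (2 * l) =
     (\<Sum>q = 0..l. \<Sum>r = q..N + q - l.
        y r * real (r choose q) * real ((N - r) choose (l - q)) * lo ^ (r - q) * hi ^ q)"
  if "l \<le> N"
proof -
  let ?f = "\<lambda>q r. y r * real (r choose q) * real ((N - r) choose (l - q)) * lo ^ (r - q) * hi ^ q"
  have "coeff (moebius_poly N lo hi y) (2 * l) = (\<Sum>r\<le>N. \<Sum>q\<le>l. ?f q r)"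
    by (simp add: moebius_poly_def coeff_pcompose_monom_2 coeff_sum coeff_mult
        coeff_linear_poly_power' sum_distrib_left mult_ac)
  also have "\<dots> = (\<Sum>q\<le>l. \<Sum>r\<le>N. ?f q r)"
    by (rule sum.swap)
  also have "\<dots> = (\<Sum>q\<le>l. \<Sum>r = q..N + q - l. ?f q r)"
  proof (rule sum.cong[OF refl], rule sum.mono_neutral_right)
    fix q assume "q \<in> {..l}"
    with that show "{q..N + q - l} \<subseteq> {..N}" by auto
    show "\<forall>r\<in>{..N} - {q..N + q - l}. ?f q r = 0"
    proof
      fix r assume r: "r \<in> {..N} - {q..N + q - l}"
      with \<open>q \<in> {..l}\<close> that have "r < q \<or> N - r < l - q" by auto
      then show "?f q r = 0" by (auto simp: binomial_eq_0)
    qed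
  qed simp
  finally show ?thesis by (simp add: atMost_atLeast0)
qed

text \<open>The substituted polynomial is even, so the constraints on odd indices also prescribe its
  coefficients, and both families merge into one.\<close>

lemma interval_constraints_iff:
  "interval_constraints n lo hi y X \<longleftrightarrow>
     (\<forall>s<2 * (n + 4) - 1. antidiagonal_sum (n + 4) X s = coeff (moebius_poly (n + 3) lo hi (($) y)) s)"
proof -
  have odd: "coeff (moebius_poly (n + 3) lo hi (($) y)) s = 0" if "odd s" for s
    using that by (simp add: moebius_poly_def coeff_pcompose_monom_2)
  have "(\<forall>s<2 * (n + 4) - 1. P s) \<longleftrightarrow>
      (\<forall>l\<in>{1..n + 3}. P (2 * l - 1)) \<and> (\<forall>l\<in>{0..n + 3}. P (2 * l))" for P
  proof safe
    fix s assume *: "\<forall>l\<in>{1..n + 3}. P (2 * l - 1)" "\<forall>l\<in>{0..n + 3}. P (2 * l)" "s < 2 * (n + 4) - 1"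
    show "P s"
    proof (cases "even s")
      case True
      then show ?thesis using *(2)[rule_format, of "s div 2"] *(3) by auto
    next
      case False
      then show ?thesis using *(1)[rule_format, of "Suc s div 2"] *(3) by (auto elim!: oddE)
    qed
  qed auto
  note split = this
  show ?thesis
    unfolding interval_constraints_def split by (simp add: odd coeff_moebius_poly)
qed

text \<open>A matrix certificate makes the substituted polynomial nonnegative on the real line,
  which is pulled back to the interval. Conversely, nonnegativity on the interval gives it on the
  line, and a sum of squares supplies the Gram matrix.\<close>

lemma psd_interval_certificate_iff:
  assumes "lo < hi"
  shows "(\<exists>X\<in>psd_cone (n + 4). interval_constraints n lo hi y X) \<longleftrightarrow>
    (\<forall>x\<in>{lo..hi}. 0 \<le> (\<Sum>r\<le>n + 3. y $ r * x ^ r))"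
proof
  let ?Q = "moebius_poly (n + 3) lo hi (($) y)"
  let ?p = "\<lambda>x. \<Sum>r\<le>n + 3. y $ r * x ^ r"
  {
    assume "\<exists>X\<in>psd_cone (n + 4). interval_constraints n lo hi y X"
    then obtain X where X: "X \<in> psd_cone (n + 4)" "interval_constraints n lo hi y X" by blast
    have Q: "0 \<le> poly ?Q t" for t
    proof -
      have "0 \<le> (\<Sum>s<2 * (n + 4) - 1. coeff ?Q s * t ^ s)"
        using psd_cone_antidiagonal_sums_nonneg[OF X(1), of t] X(2)
        by (simp add: interval_constraints_iff)
      also have "\<dots> = (\<Sum>s\<le>degree ?Q. coeff ?Q s * t ^ s)"
        using degree_moebius_poly[of "n + 3" lo hi "($) y"]
        by (intro sum.mono_neutral_right) (auto simp: coeff_eq_0)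
      finally show ?thesis by (simp add: poly_altdef)
    qed
    have half_open: "0 \<le> ?p x" if "x \<in> {lo..<hi}" for x
    proof -
      \<comment> \<open>This \<open>t\<close> inverts the Moebius substitution at
        \<open>x\<close>.\<close>
      define t where "t = sqrt ((x - lo) / (hi - x))"
      have t: "t\<^sup>2 = (x - lo) / (hi - x)" using that by (simp add: t_def)
      have "1 + t\<^sup>2 = (hi - lo) / (hi - x)" "lo + hi * t\<^sup>2 = x * (hi - lo) / (hi - x)"
        using that unfolding t by (simp_all add: field_simps)
      then have "(lo + hi * t\<^sup>2) / (1 + t\<^sup>2) = x"
        using that assms by simp
      moreover have "0 < (1 + t\<^sup>2) ^ (n + 3)"
        by (intro zero_less_power add_pos_nonneg) auto
      ultimately show ?thesis
        using Q[of t] by (simp add: poly_moebius_poly zero_le_mult_iff)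
    qed
    \<comment> \<open>The endpoint \<open>hi\<close> corresponds to infinite \<open>t\<close> and is
      reached only as a limit.\<close>
    show "\<forall>x\<in>{lo..hi}. 0 \<le> ?p x"
    proof
      fix x assume "x \<in> {lo..hi}"
      moreover have "continuous_on (closure {lo..<hi}) ?p" by (intro continuous_intros)
      ultimately show "0 \<le> ?p x"
        using assms half_open by (intro continuous_ge_on_closure[of "{lo..<hi}" ?p x 0]) simp_all
    qed
  }
  assume nonneg: "\<forall>x\<in>{lo..hi}. 0 \<le> ?p x"
  have "0 \<le> poly ?Q t" for t
  proof -
    have pos: "0 < 1 + t\<^sup>2" by (simp add: add_pos_nonneg)
    have "lo * t\<^sup>2 \<le> hi * t\<^sup>2" using assms by (simp add: mult_right_mono)
    then have "(lo + hi * t\<^sup>2) / (1 + t\<^sup>2) \<in> {lo..hi}"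
      using pos assms by (simp add: field_simps)
    with nonneg pos show ?thesis unfolding poly_moebius_poly by simp
  qed
  then obtain qs where qs: "?Q = (\<Sum>q\<leftarrow>qs. q\<^sup>2)" "\<forall>q\<in>set qs. 2 * degree q \<le> degree ?Q"
    using nonneg_poly_sum_of_squares by blast
  \<comment> \<open>\<open>?Q\<close> has degree at most \<open>2 * (n + 3)\<close>, so each squared
    polynomial has degree at most \<open>n + 3\<close> and fits a Gram matrix of size
    \<open>n + 4\<close>.\<close>
  have "degree q < n + 4" if "q \<in> set qs" for q
    using qs(2) that degree_moebius_poly[of "n + 3" lo hi "($) y"] by fastforce
  then show "\<exists>X\<in>psd_cone (n + 4). interval_constraints n lo hi y X"
    by (intro bexI[OF _ psd_cone_Gram[of "n + 4" qs]])
      (simp add: interval_constraints_iff antidiagonal_sum_Gram qs(1))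
qed

section \<open>Duality for the moment problem\<close>

lemma borel_measurable_continuous_interval:
  fixes g :: "real \<Rightarrow> real"
  assumes "continuous_on {a..b} g" "sets P = sets (restrict_space borel {a..b})"
  shows "g \<in> borel_measurable P"
  using borel_measurable_continuous_on_restrict[OF assms(1)] measurable_cong_sets[OF assms(2) refl]
  by auto

lemma integrable_continuous_interval:
  fixes g :: "real \<Rightarrow> real"
  assumes "prob_space P" "continuous_on {a..b} g" "sets P = sets (restrict_space borel {a..b})"
  shows "integrable P g"
proof -
  interpret prob_space P by fact
  have "bounded (g ` {a..b})"
    using assms(2) by (intro compact_imp_bounded compact_continuous_image) auto
  then obtain B where "\<And>x. x \<in> {a..b} \<Longrightarrow> norm (g x) \<le> B"
    unfolding bounded_iff by blast
  moreover have "space P = {a..b}"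
    using sets_eq_imp_space_eq[OF assms(3)] by (simp add: space_restrict_space)
  ultimately show ?thesis
    using borel_measurable_continuous_interval[OF assms(2,3)]
    by (intro integrable_const_bound[where B = B]) (auto intro!: AE_I2)
qed

lemma finite_support_prob_measure:
  fixes u :: "real \<Rightarrow> real"
  assumes "finite A" "A \<subseteq> {a..b}" "\<And>x. x \<in> A \<Longrightarrow> 0 \<le> u x" "sum u A = 1"
  obtains P where "prob_space P" "sets P = sets (restrict_space borel {a..b})"
    "\<And>g::real \<Rightarrow> real. continuous_on {a..b} g \<Longrightarrow>
       prob_space.expectation P g = (\<Sum>x\<in>A. u x * g x)"
proof -
  define w where "w x = (if x \<in> A then u x else 0)" for x
  have w0: "0 \<le> w x" for x using assms(3) by (simp add: w_def)
  have "(\<integral>\<^sup>+x. ennreal (w x) \<partial>count_space UNIV) = (\<Sum>x\<in>A. ennreal (w x))"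
    using assms(1) by (intro nn_integral_count_space') (auto simp: w_def)
  also have "\<dots> = ennreal (sum u A)"
    using assms(3) by (subst sum_ennreal) (auto simp: w_def)
  finally have w1: "(\<integral>\<^sup>+x. ennreal (w x) \<partial>count_space UNIV) = 1"
    using assms(4) by simp
  define p where "p = embed_pmf w"
  have pmf: "pmf p x = w x" for x
    unfolding p_def by (rule pmf_embed_pmf[OF w0 w1])
  have "A \<noteq> {}" using assms(4) by auto
  then have "a \<le> b" using assms(2) by auto
  \<comment> \<open>The discrete distribution lives on all reals; clamping to \<open>[a, b]\<close>
    is a measurable map into the restricted Borel space that fixes every point of
    \<open>A\<close>.\<close>
  define h where "h x = max a (min b x)" for x :: real
  have h_id: "h x = x" if "x \<in> A" for x using assms(2) that by (auto simp: h_def)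
  let ?M = "restrict_space borel {a..b} :: real measure"
  have h: "h \<in> measurable (measure_pmf p) ?M"
    using \<open>a \<le> b\<close> by (simp add: measurable_restrict_space2_iff h_def)
  define P where "P = distr (measure_pmf p) ?M h"
  have "prob_space P"
    unfolding P_def by (intro prob_space.prob_space_distr measure_pmf.prob_space_axioms h)
  moreover have "sets P = sets ?M" by (simp add: P_def)
  moreover have "prob_space.expectation P g = (\<Sum>x\<in>A. u x * g x)"
    if "continuous_on {a..b} g" for g :: "real \<Rightarrow> real"
  proof -
    have "prob_space.expectation P g = measure_pmf.expectation p (\<lambda>x. g (h x))"
      unfolding P_def
      by (rule integral_distr[OF h borel_measurable_continuous_on_restrict[OF that]])
    also have "\<dots> = (\<Sum>x\<in>A. pmf p x *\<^sub>R g (h x))"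
      using assms(1) by (intro integral_measure_pmf) (auto simp: set_pmf_iff pmf w_def split: if_splits)
    also have "\<dots> = (\<Sum>x\<in>A. u x * g x)"
      by (intro sum.cong) (auto simp: pmf w_def h_id)
    finally show ?thesis .
  qed
  ultimately show thesis by (rule that)
qed

text \<open>Put mass \<open>p\<close> at \<open>a\<close>, \<open>q\<close> at \<open>b\<close> and
  the rest at \<open>m\<close>. Each side contributes \<open>d / 2\<close> to the deviation, which
  also balances the mean; the bound on \<open>d\<close> amounts to
  \<open>p + q \<le> 1\<close>.\<close>

lemma mad_ambiguity_set_nonempty:
  fixes a b m d :: real
  assumes "m \<in> {a<..<b}" "0 < d" "d \<le> 2 * (m - a) * (b - m) / (b - a)"
  shows "mad_ambiguity_set a b m d \<noteq> {}"
proof -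
  define p q where "p = d / 2 / (m - a)" and "q = d / 2 / (b - m)"
  have pq: "0 \<le> p" "0 \<le> q" "p * (m - a) = d / 2" "q * (b - m) = d / 2"
    using assms(1,2)
    by (simp_all only: p_def q_def) (simp_all del: divide_divide_eq_left divide_divide_eq_left')
  define u where "u x = (if x = a then p else if x = b then q else 1 - p - q)" for x
  have "p + q = d * (b - a) / (2 * (m - a) * (b - m))"
    using assms(1) by (simp add: p_def q_def divide_simps) (simp add: algebra_simps)
  also have "\<dots> \<le> 1"
  proof -
    have "d * (b - a) \<le> 2 * (m - a) * (b - m)" "0 < 2 * (m - a) * (b - m)"
      using assms(1,3) by (simp_all add: pos_le_divide_eq)
    then show ?thesis by (simp only: divide_le_eq_1_pos)
  qed
  finally have le: "p + q \<le> 1" .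
  have ne: "a \<noteq> m" "a \<noteq> b" "b \<noteq> m" using assms(1) by auto
  have "0 \<le> u x" if "x \<in> {a, m, b}" for x
    using that pq le by (auto simp: u_def)
  moreover have "sum u {a, m, b} = 1"
    using ne by (simp add: u_def)
  ultimately obtain P where P: "prob_space P" "sets P = sets (restrict_space borel {a..b})"
    "\<And>g::real \<Rightarrow> real. continuous_on {a..b} g \<Longrightarrow>
       prob_space.expectation P g = (\<Sum>x\<in>{a, m, b}. u x * g x)"
    using assms(1) by (auto intro: finite_support_prob_measure[of "{a, m, b}" a b u])
  have "prob_space.expectation P (\<lambda>\<rho>. \<rho>) = (\<Sum>x\<in>{a, m, b}. u x * x)"
    by (intro P(3) continuous_intros)
  also have "\<dots> = m"
    using ne pq(3,4) by (simp add: u_def algebra_simps)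
  finally have "prob_space.expectation P (\<lambda>\<rho>. \<rho>) = m" .
  moreover have "prob_space.expectation P (\<lambda>\<rho>. \<bar>\<rho> - m\<bar>) = (\<Sum>x\<in>{a, m, b}. u x * \<bar>x - m\<bar>)"
    by (intro P(3) continuous_intros)
  then have "prob_space.expectation P (\<lambda>\<rho>. \<bar>\<rho> - m\<bar>) = d"
    using ne pq(3,4) assms(1) by (simp add: u_def abs_if algebra_simps)
  ultimately show ?thesis
    using P(1,2) by (auto simp: mad_ambiguity_set_def)
qed

lemma mad_expectation_affine:
  assumes "P \<in> mad_ambiguity_set a b m d"
  shows "integrable P (\<lambda>\<rho>. \<alpha> * \<bar>\<rho> - m\<bar> + \<beta> * \<rho> + \<gamma>)"
    and "prob_space.expectation P (\<lambda>\<rho>. \<alpha> * \<bar>\<rho> - m\<bar> + \<beta> * \<rho> + \<gamma>) = \<alpha> * d + \<beta> * m + \<gamma>"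
proof -
  from assms interpret prob_space P by (simp add: mad_ambiguity_set_def)
  have P: "sets P = sets (restrict_space borel {a..b})" "expectation (\<lambda>\<rho>. \<rho>) = m"
    "expectation (\<lambda>\<rho>. \<bar>\<rho> - m\<bar>) = d"
    using assms by (auto simp: mad_ambiguity_set_def)
  have int: "integrable P (\<lambda>\<rho>. \<rho>)" "integrable P (\<lambda>\<rho>. \<bar>\<rho> - m\<bar>)"
    by (rule integrable_continuous_interval[OF prob_space_axioms _ P(1)], intro continuous_intros)+
  then show "integrable P (\<lambda>\<rho>. \<alpha> * \<bar>\<rho> - m\<bar> + \<beta> * \<rho> + \<gamma>)" by simp
  show "expectation (\<lambda>\<rho>. \<alpha> * \<bar>\<rho> - m\<bar> + \<beta> * \<rho> + \<gamma>) = \<alpha> * d + \<beta> * m + \<gamma>"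
    using int by (simp add: P prob_space)
qed

text \<open>The two moments determine the expectation of the minorant, so monotonicity of the
  integral suffices.\<close>

lemma mad_weak_duality:
  assumes "P \<in> mad_ambiguity_set a b m d" "continuous_on {a..b} f"
    and "\<And>\<rho>. \<rho> \<in> {a..b} \<Longrightarrow> \<alpha> * \<bar>\<rho> - m\<bar> + \<beta> * \<rho> + \<gamma> \<le> f \<rho>"
  shows "\<alpha> * d + \<beta> * m + \<gamma> \<le> prob_space.expectation P f"
proof -
  have P: "prob_space P" "sets P = sets (restrict_space borel {a..b})"
    using assms(1) by (auto simp: mad_ambiguity_set_def)
  have "space P = {a..b}"
    using sets_eq_imp_space_eq[OF P(2)] by (simp add: space_restrict_space)
  with assms(3) mad_expectation_affine(1)[OF assms(1)]
      integrable_continuous_interval[OF P(1) assms(2) P(2)]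
  have "prob_space.expectation P (\<lambda>\<rho>. \<alpha> * \<bar>\<rho> - m\<bar> + \<beta> * \<rho> + \<gamma>) \<le> prob_space.expectation P f"
    by (intro integral_mono) auto
  then show ?thesis by (simp add: mad_expectation_affine(2)[OF assms(1)])
qed

text \<open>Separate \<open>(m, d, v)\<close> from the compact convex hull of the moment curve
  \<open>(\<rho>, \<bar>\<rho> - m\<bar>, f \<rho>)\<close>, closed upwards in the last coordinate. The last component of the normal
  vector is positive because some measure has the moments \<open>m\<close> and \<open>d\<close>.\<close>

lemma mad_strong_duality:
  fixes f :: "real \<Rightarrow> real"
  assumes cont: "continuous_on {a..b} f" and nonempty: "mad_ambiguity_set a b m d \<noteq> {}"
    and no_measure: "\<And>P. P \<in> mad_ambiguity_set a b m d \<Longrightarrow> v < prob_space.expectation P f"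
  shows "\<exists>\<alpha> \<beta> \<gamma>. (\<forall>\<rho>\<in>{a..b}. \<alpha> * \<bar>\<rho> - m\<bar> + \<beta> * \<rho> + \<gamma> \<le> f \<rho>) \<and> v < \<alpha> * d + \<beta> * m + \<gamma>"
proof -
  define c where "c \<rho> = (\<rho>, \<bar>\<rho> - m\<bar>, f \<rho>)" for \<rho>
  \<comment> \<open>A vertical ray: its sum with the compact hull is closed and convex, as strict
    separation of a point requires.\<close>
  define U where "U = (\<lambda>t. (0::real, 0::real, t)) ` {0::real..}"
  define T where "T = (\<Union>x\<in>convex hull (c ` {a..b}). \<Union>y\<in>U. {x + y})"
  have "compact (convex hull (c ` {a..b}))"
    unfolding c_def using cont
    by (intro compact_convex_hull compact_continuous_image) (auto intro!: continuous_intros)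
  moreover have "U = {0} \<times> {0} \<times> {0..}" by (auto simp: U_def)
  then have "closed U" "convex U"
    by (auto intro!: closed_Times convex_Times)
  ultimately have "closed T" "convex T"
    unfolding T_def using compact_closed_sums convex_sums[OF convex_convex_hull] by blast+
  \<comment> \<open>A hull point at or below level \<open>v\<close> is a finite convex combination
    of curve points; its weights define a measure with moments \<open>m\<close> and \<open>d\<close>
    and expectation \<open>v - t\<close>, against \<open>no_measure\<close>.\<close>
  moreover have "(m, d, v) \<notin> T"
  proof
    assume "(m, d, v) \<in> T"
    then obtain t where t: "t \<ge> 0" "(m, d, v - t) \<in> convex hull (c ` {a..b})"
      by (force simp: T_def U_def)
    then obtain S u where S: "finite S" "S \<subseteq> c ` {a..b}" "\<And>x. x \<in> S \<Longrightarrow> 0 \<le> u x" "sum u S = 1"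
      "(\<Sum>x\<in>S. u x *\<^sub>R x) = (m, d, v - t)"
      unfolding convex_hull_explicit by blast
    \<comment> \<open>The first coordinate recovers \<open>\<rho>\<close>, so weights on curve
      points become weights on the nodes \<open>A\<close>.\<close>
    have inj: "inj c" by (auto simp: inj_def c_def)
    define A where "A = c -` S"
    have A: "S = c ` A" "A \<subseteq> {a..b}"
    proof -
      show "S = c ` A" using S(2) unfolding A_def by blast
      show "A \<subseteq> {a..b}"
      proof
        fix x assume "x \<in> A"
        then have "c x \<in> c ` {a..b}" using S(2) unfolding A_def by blast
        then show "x \<in> {a..b}" by (simp only: inj_image_mem_iff[OF inj])
      qed
    qed
    have sum_A: "sum g S = (\<Sum>x\<in>A. g (c x))" for g :: "_ \<Rightarrow> 'z::comm_monoid_add"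
      unfolding A(1) by (subst sum.reindex) (auto intro: inj_on_subset[OF inj])
    have "finite A" using S(1) inj unfolding A_def by (intro finite_vimageI)
    moreover have "0 \<le> u (c x)" if "x \<in> A" for x using S(3) that by (auto simp: A_def)
    moreover have "(\<Sum>x\<in>A. u (c x)) = 1" using S(4) by (simp add: sum_A)
    ultimately obtain P where P: "prob_space P" "sets P = sets (restrict_space borel {a..b})"
      "\<And>g::real \<Rightarrow> real. continuous_on {a..b} g \<Longrightarrow>
         prob_space.expectation P g = (\<Sum>x\<in>A. u (c x) * g x)"
      using A(2) by (auto intro: finite_support_prob_measure[of A a b "\<lambda>x. u (c x)"])
    have "(\<Sum>x\<in>A. u (c x) *\<^sub>R c x) = (m, d, v - t)"
      using S(5) by (simp add: sum_A)
    then have "(\<Sum>x\<in>A. u (c x) * x) = m" "(\<Sum>x\<in>A. u (c x) * \<bar>x - m\<bar>) = d"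
      "(\<Sum>x\<in>A. u (c x) * f x) = v - t"
      by (simp_all add: c_def prod_eq_iff fst_sum snd_sum)
    moreover have "prob_space.expectation P (\<lambda>x. x) = (\<Sum>x\<in>A. u (c x) * x)"
      "prob_space.expectation P (\<lambda>x. \<bar>x - m\<bar>) = (\<Sum>x\<in>A. u (c x) * \<bar>x - m\<bar>)"
      "prob_space.expectation P f = (\<Sum>x\<in>A. u (c x) * f x)"
      by (intro P(3) continuous_intros cont)+
    ultimately have "P \<in> mad_ambiguity_set a b m d" "prob_space.expectation P f = v - t"
      using P(1,2) by (simp_all add: mad_ambiguity_set_def)
    with no_measure[of P] t(1) show False by simp
  qed
  ultimately have "\<exists>w s. inner w (m, d, v) < s \<and> (\<forall>x\<in>T. inner w x > s)"
    by (intro separating_hyperplane_closed_point)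
  then obtain w s where w: "inner w (m, d, v) < s" "\<And>x. x \<in> T \<Longrightarrow> s < inner w x"
    by blast
  obtain p q r where pqr: "w = (p, q, r)" by (cases w)
  have sep: "s < p * \<rho> + q * \<bar>\<rho> - m\<bar> + r * (f \<rho> + t)" if "\<rho> \<in> {a..b}" "0 \<le> t" for \<rho> t
  proof -
    have "c \<rho> + (0, 0, t) \<in> T"
      unfolding T_def U_def using that
      by (intro UN_I[of "c \<rho>"] UN_I[of "(0, 0, t)"] hull_inc imageI) simp_all
    from w(2)[OF this] show ?thesis by (simp add: pqr c_def algebra_simps)
  qed
  obtain P where P: "P \<in> mad_ambiguity_set a b m d" using nonempty by blast
  have r: "0 < r"
  proof (rule ccontr)
    assume "\<not> 0 < r"
    then consider "r = 0" | "r < 0" by linarith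
    then show False
    proof cases
      case 1
      \<comment> \<open>A vertical hyperplane would give a minorant of the zero function; its
        expectation \<open>s - p * m - q * d\<close> under \<open>P\<close> would be at most 0,
        contradicting the separation of \<open>(m, d, v)\<close>.\<close>
      have "(- q) * \<bar>\<rho> - m\<bar> + (- p) * \<rho> + s \<le> 0" if "\<rho> \<in> {a..b}" for \<rho>
        using sep[OF that, of 0] 1 by simp
      from mad_weak_duality[OF P continuous_on_const this] show False
        using w(1) 1 by (simp add: pqr)
    next
      case 2
      have "{a..b} \<noteq> {}"
        using P prob_space.not_empty[of P] sets_eq_imp_space_eq[of P "restrict_space borel {a..b}"]
        by (auto simp: mad_ambiguity_set_def space_restrict_space)
      then obtain \<rho> where \<rho>: "\<rho> \<in> {a..b}" by blast
      define K where "K = p * \<rho> + q * \<bar>\<rho> - m\<bar> + r * f \<rho>"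
      \<comment> \<open>Moving up the ray by this amount changes the form by
        \<open>- \<bar>K - s\<bar>\<close>, which brings it down to \<open>s\<close> or
        below.\<close>
      have "0 \<le> \<bar>K - s\<bar> / (- r)" using 2 by (intro divide_nonneg_pos) auto
      then have "s < K + r * (\<bar>K - s\<bar> / (- r))"
        using sep[OF \<rho>, of "\<bar>K - s\<bar> / (- r)"] by (simp add: K_def algebra_simps)
      with 2 show False by simp
    qed
  qed
  \<comment> \<open>The multipliers come from dividing the separating inequalities by
    \<open>r\<close> and solving for \<open>f \<rho>\<close> and \<open>v\<close>.\<close>
  show ?thesis
  proof (rule exI[of _ "- q / r"], rule exI[of _ "- p / r"], rule exI[of _ "s / r"], intro conjI ballI)
    fix \<rho> assume "\<rho> \<in> {a..b}"
    from sep[OF this, of 0] r show "(- q / r) * \<bar>\<rho> - m\<bar> + (- p / r) * \<rho> + s / r \<le> f \<rho>"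
      by (simp add: field_simps)
  next
    show "v < (- q / r) * d + (- p / r) * m + s / r"
      using w(1) r by (simp add: pqr field_simps)
  qed
qed

section \<open>Affine minorants of the social benefit\<close>

text \<open>Adding monomials, instead of prescribing coefficients, also covers \<open>n = 1\<close>, where two of them
  have degree \<open>2\<close>.\<close>

definition minorant_poly :: "real \<Rightarrow> real \<Rightarrow> real \<Rightarrow> nat \<Rightarrow> real \<Rightarrow> real \<Rightarrow> real poly" where
  "minorant_poly R C \<mu> n u v =
     monom u 0 + monom (R * \<mu> - C - u + v) 1 + monom (- (R * \<mu>) - v) 2
     + monom (- (R * \<mu>) + C * real (n + 1) - u) (n + 1)
     + monom (R * \<mu> - C * real n + u - v) (n + 2) + monom v (n + 3)"

lemma degree_minorant_poly: "degree (minorant_poly R C \<mu> n u v) \<le> n + 3"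
  unfolding minorant_poly_def
  by (intro degree_add_le order.trans[OF degree_monom_le]) auto

text \<open>The first and last entries of \<open>y\<close> act as the parameters of
  \<open>minorant_poly\<close>; the constraints fix all entries between them.\<close>

lemma coefficient_constraints_iff:
  assumes "n \<ge> 1"
  shows "coefficient_constraints R C \<mu> n y \<longleftrightarrow>
    (\<forall>r\<le>n + 3. y $ r = coeff (minorant_poly R C \<mu> n (y $ 0) (y $ (n + 3))) r)"
    (is "_ \<longleftrightarrow> ?R")
proof
  assume *: "coefficient_constraints R C \<mu> n y"
  show ?R
  proof (intro allI impI)
    fix r assume "r \<le> n + 3"
    then consider "r = 0" | "r = 1" | "r = 2" | "r \<in> {3..n}" | "r = n + 1" | "r = n + 2" | "r = n + 3"
      by fastforce
    then show "y $ r = coeff (minorant_poly R C \<mu> n (y $ 0) (y $ (n + 3))) r"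
      using * assms
      by cases (auto simp: coefficient_constraints_def minorant_poly_def numeral_2_eq_2 split: if_splits)
  qed
next
  assume R: ?R
  have "y $ r = 0" if "r \<in> {3..n}" for r
    using R[rule_format, of r] that by (simp add: minorant_poly_def)
  then show "coefficient_constraints R C \<mu> n y"
    unfolding coefficient_constraints_def
    using R[rule_format, of 1] R[rule_format, of 2] R[rule_format, of "n + 1"]
      R[rule_format, of "n + 2"] assms
    by (auto simp: minorant_poly_def)
qed

text \<open>The arithmetic-geometric sum, cleared of denominators; it identifies the second fraction
  of the social benefit.\<close>

lemma sum_index_power_telescope:
  fixes x :: "'a::comm_ring_1"
  shows "(1 - x)\<^sup>2 * (\<Sum>k\<le>n. of_nat k * x ^ k) = x * (1 - x ^ (n + 1)) - of_nat (n + 1) * x ^ (n + 1) * (1 - x)"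
  by (induction n) (simp_all add: algebra_simps power2_eq_square)

lemma one_le_sum_powers: "1 \<le> (\<Sum>k\<le>n. \<rho> ^ k)" if "0 \<le> \<rho>" for \<rho> :: real
proof -
  have "(\<Sum>k\<in>{0}. \<rho> ^ k) \<le> (\<Sum>k\<le>n. \<rho> ^ k)"
    using that by (intro sum_mono2) auto
  then show ?thesis by simp
qed

text \<open>Cancelling powers of \<open>1 - \<rho>\<close> leaves the common denominator
  \<open>\<Sum>k\<le>n. \<rho> ^ k\<close>, which is at least 1. The exceptional point disappears,
  and continuity at 1 becomes visible.\<close>

lemma social_benefit_eq:
  assumes "0 \<le> \<rho>"
  shows "social_benefit R C \<mu> n \<rho> =
    (R * \<mu> * (\<rho> * (\<Sum>k<n. \<rho> ^ k)) - C * (\<Sum>k\<le>n. real k * \<rho> ^ k)) / (\<Sum>k\<le>n. \<rho> ^ k)"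
proof (cases "\<rho> = 1")
  case True
  have sum: "(\<Sum>k\<le>n. real k) = real n * (real n + 1) / 2"
    by (induction n) (simp_all add: field_simps)
  show ?thesis unfolding social_benefit_def True by (simp add: sum divide_simps) (simp add: algebra_simps)
next
  case False
  define S T where "S = (\<Sum>k\<le>n. \<rho> ^ k)" and "T = (\<Sum>k\<le>n. real k * \<rho> ^ k)"
  have "S \<noteq> 0" using one_le_sum_powers[OF assms, of n] by (simp add: S_def)
  have nz: "1 - \<rho> \<noteq> 0" using False by simp
  have pow: "1 - \<rho> ^ (n + 1) = (1 - \<rho>) * S"
    using one_diff_power_eq[of \<rho> "n + 1"] by (simp add: S_def lessThan_Suc_atMost)
  have "\<rho> * (1 - \<rho> ^ n) / (1 - \<rho> ^ (n + 1)) = \<rho> * (\<Sum>k<n. \<rho> ^ k) / S"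
    unfolding pow one_diff_power_eq[of \<rho> n] using nz by simp
  moreover have "\<rho> / (1 - \<rho>) - real (n + 1) * \<rho> ^ (n + 1) / (1 - \<rho> ^ (n + 1)) =
      (\<rho> * (1 - \<rho> ^ (n + 1)) - real (n + 1) * \<rho> ^ (n + 1) * (1 - \<rho>)) / ((1 - \<rho>)\<^sup>2 * S)"
    unfolding pow using nz \<open>S \<noteq> 0\<close> by (simp add: divide_simps power2_eq_square) (simp add: algebra_simps)
  then have "\<rho> / (1 - \<rho>) - real (n + 1) * \<rho> ^ (n + 1) / (1 - \<rho> ^ (n + 1)) = T / S"
    using nz by (simp only: sum_index_power_telescope[symmetric] T_def) simp
  ultimately show ?thesis
    using False by (simp add: social_benefit_def S_def T_def diff_divide_distrib)
qed

lemma continuous_on_social_benefit: "continuous_on {0..} (social_benefit R C \<mu> n)"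
proof -
  have "(\<Sum>k\<le>n. \<rho> ^ k) \<noteq> 0" if "\<rho> \<in> {0..}" for \<rho> :: real
    using one_le_sum_powers[of \<rho> n] that by auto
  then have "continuous_on {0..} (\<lambda>\<rho>. (R * \<mu> * (\<rho> * (\<Sum>k<n. \<rho> ^ k)) - C * (\<Sum>k\<le>n. real k * \<rho> ^ k)) /
      (\<Sum>k\<le>n. \<rho> ^ k))"
    by (intro continuous_intros) auto
  then show ?thesis
    by (rule continuous_on_eq) (simp add: social_benefit_eq)
qed

text \<open>The factors \<open>1 - \<rho>\<close> and \<open>1 - \<rho> ^ (n + 1)\<close> have the
  same sign on either side of 1, so clearing both denominators preserves the sign of the
  gap.\<close>

lemma poly_minorant_poly:
  assumes "0 \<le> \<rho>" "\<rho> \<noteq> 1"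
  shows "poly (minorant_poly R C \<mu> n (- A) (- B)) \<rho> =
    (1 - \<rho>) * (1 - \<rho> ^ (n + 1)) * (social_benefit R C \<mu> n \<rho> - (A + B * \<rho>))"
    and "0 < (1 - \<rho>) * (1 - \<rho> ^ (n + 1))"
proof -
  show pos: "0 < (1 - \<rho>) * (1 - \<rho> ^ (n + 1))"
  proof (cases "\<rho> < 1")
    case True
    with assms have "\<rho> ^ (n + 1) < 1" using power_strict_mono[of \<rho> 1 "n + 1"] by simp
    with True show ?thesis by simp
  next
    case False
    with assms have "1 < \<rho>" "1 < \<rho> ^ (n + 1)" by (auto intro!: one_less_power simp del: power_Suc)
    then show ?thesis by (simp add: mult_neg_neg)
  qed
  then have nz: "1 - \<rho> \<noteq> 0" "1 - \<rho> ^ (n + 1) \<noteq> 0" by auto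
  \<comment> \<open>Abstracting the denominators to \<open>x\<close> and \<open>y\<close> cancels
    them before the powers of \<open>\<rho>\<close> are expanded.\<close>
  have "x * y * (r * (e / y) - c * (\<rho> / x - f / y)) = r * (e * x) - c * (\<rho> * y - f * x)"
    if "x \<noteq> 0" "y \<noteq> 0" for x y r e c f :: real
    using that by (simp add: field_simps)
  from this[OF nz] have "(1 - \<rho>) * (1 - \<rho> ^ (n + 1)) * social_benefit R C \<mu> n \<rho> =
      R * \<mu> * (\<rho> * (1 - \<rho> ^ n) * (1 - \<rho>)) -
      C * (\<rho> * (1 - \<rho> ^ (n + 1)) - real (n + 1) * \<rho> ^ (n + 1) * (1 - \<rho>))"
    using assms(2) unfolding social_benefit_def by (simp only: if_False)
  then show "poly (minorant_poly R C \<mu> n (- A) (- B)) \<rho> =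
      (1 - \<rho>) * (1 - \<rho> ^ (n + 1)) * (social_benefit R C \<mu> n \<rho> - (A + B * \<rho>))"
    unfolding right_diff_distrib[of _ "social_benefit R C \<mu> n \<rho>"]
    by (simp add: minorant_poly_def poly_monom algebra_simps power2_eq_square numeral_3_eq_3)
qed

text \<open>Away from 1 the multiplier is positive. At 1 the polynomial vanishes and carries no
  information, so the inequality there is a limit of those at nearby points.\<close>

lemma affine_minorant_iff_poly_nonneg:
  assumes "0 \<le> lo" "lo < hi"
  shows "(\<forall>\<rho>\<in>{lo..hi}. A + B * \<rho> \<le> social_benefit R C \<mu> n \<rho>) \<longleftrightarrow>
    (\<forall>\<rho>\<in>{lo..hi}. 0 \<le> poly (minorant_poly R C \<mu> n (- A) (- B)) \<rho>)"
proof -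
  let ?g = "\<lambda>\<rho>. social_benefit R C \<mu> n \<rho> - (A + B * \<rho>)"
  let ?h = "poly (minorant_poly R C \<mu> n (- A) (- B))"
  have iff: "0 \<le> ?g \<rho> \<longleftrightarrow> 0 \<le> ?h \<rho>" if "\<rho> \<in> {lo..hi}" "\<rho> \<noteq> 1" for \<rho>
  proof -
    have "0 \<le> \<rho>" using that assms(1) by simp
    have "0 \<le> y \<longleftrightarrow> 0 \<le> x * y" if "0 < x" for x y :: real
      using that by (simp add: zero_le_mult_iff)
    from this[OF poly_minorant_poly(2)] show ?thesis
      using \<open>0 \<le> \<rho>\<close> that(2) by (simp only: poly_minorant_poly(1) simp_thms)
  qed
  have h1: "?h 1 = 0"
    by (simp add: minorant_poly_def poly_monom algebra_simps)
  have cont: "continuous_on S ?g" if "S \<subseteq> {lo..hi}" for S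
    using that assms(1)
    by (intro continuous_intros continuous_on_subset[OF continuous_on_social_benefit]) auto
  have "0 \<le> ?g 1" if nonneg: "\<forall>\<rho>\<in>{lo..hi}. 0 \<le> ?h \<rho>" and 1: "1 \<in> {lo..hi}"
  proof -
    \<comment> \<open>\<open>S\<close> approaches 1 from inside the interval: from the right if
      there is room, otherwise from the left.\<close>
    obtain S where S: "S \<subseteq> {lo..hi} - {1}" "1 \<in> closure S" "closure S \<subseteq> {lo..hi}"
    proof (cases "1 < hi")
      case True
      with 1 show ?thesis by (intro that[of "{1<..<hi}"]) auto
    next
      case False
      with 1 assms(2) show ?thesis by (intro that[of "{lo<..<1}"]) auto
    qed
    have "0 \<le> ?g \<rho>" if "\<rho> \<in> S" for \<rho>
      using iff[of \<rho>] nonneg S(1) that by blast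
    then show ?thesis
      by (rule continuous_ge_on_closure[OF cont[OF S(3)] S(2)])
  qed
  with iff h1 have "(\<forall>\<rho>\<in>{lo..hi}. 0 \<le> ?g \<rho>) \<longleftrightarrow> (\<forall>\<rho>\<in>{lo..hi}. 0 \<le> ?h \<rho>)"
    by (metis order_refl)
  then show ?thesis by simp
qed

text \<open>The line determines every entry of \<open>y\<close> as a coefficient of
  \<open>minorant_poly\<close>, so only the existence of \<open>X\<close> remains, and that is
  nonnegativity on the interval.\<close>

lemma affine_minorant_certificate_iff:
  assumes "n \<ge> 1" "0 \<le> lo" "lo < hi"
  shows "(\<exists>y X. y \<in> carrier_vec (n + 4) \<and> X \<in> psd_cone (n + 4) \<and> y $ 0 = - A \<and> y $ (n + 3) = - B \<and>
      coefficient_constraints R C \<mu> n y \<and> interval_constraints n lo hi y X) \<longleftrightarrow>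
    (\<forall>\<rho>\<in>{lo..hi}. A + B * \<rho> \<le> social_benefit R C \<mu> n \<rho>)" (is "?L \<longleftrightarrow> _")
proof -
  let ?h = "minorant_poly R C \<mu> n (- A) (- B)"
  have sum: "(\<Sum>r\<le>n + 3. y $ r * x ^ r) = poly ?h x" if "\<forall>r\<le>n + 3. y $ r = coeff ?h r" for y x
  proof -
    have "(\<Sum>r\<le>n + 3. y $ r * x ^ r) = (\<Sum>r\<le>n + 3. coeff ?h r * x ^ r)"
      using that by (intro sum.cong) auto
    also have "\<dots> = (\<Sum>r\<le>degree ?h. coeff ?h r * x ^ r)"
      using degree_minorant_poly[of R C \<mu> n "- A" "- B"]
      by (intro sum.mono_neutral_right) (auto simp: coeff_eq_0)
    finally show ?thesis by (simp add: poly_altdef)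
  qed
  have h: "coeff ?h 0 = - A" "coeff ?h (n + 3) = - B"
    using assms(1) by (auto simp: minorant_poly_def)
  have coeffs: "y $ 0 = - A \<and> y $ (n + 3) = - B \<and> coefficient_constraints R C \<mu> n y \<longleftrightarrow>
      (\<forall>r\<le>n + 3. y $ r = coeff ?h r)" (is "?P \<longleftrightarrow> ?Q") for y
  proof
    assume ?P
    then show ?Q using coefficient_constraints_iff[OF assms(1), of R C \<mu> y] by simp
  next
    assume ?Q
    then have "y $ 0 = - A" "y $ (n + 3) = - B" using h by simp_all
    with \<open>?Q\<close> show ?P using coefficient_constraints_iff[OF assms(1), of R C \<mu> y] by simp
  qed
  have "?L \<longleftrightarrow> (\<exists>y\<in>carrier_vec (n + 4). (\<forall>r\<le>n + 3. y $ r = coeff ?h r) \<and>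
      (\<exists>X\<in>psd_cone (n + 4). interval_constraints n lo hi y X))"
    using coeffs by blast
  also have "\<dots> \<longleftrightarrow> (\<exists>y\<in>carrier_vec (n + 4). (\<forall>r\<le>n + 3. y $ r = coeff ?h r) \<and>
      (\<forall>x\<in>{lo..hi}. 0 \<le> poly ?h x))"
    unfolding psd_interval_certificate_iff[OF assms(3)] using sum by auto
  also have "\<dots> \<longleftrightarrow> (\<forall>x\<in>{lo..hi}. 0 \<le> poly ?h x)"
    by (auto intro!: bexI[of _ "vec (n + 4) (coeff ?h)"])
  finally show ?thesis
    by (simp add: affine_minorant_iff_poly_nonneg[OF assms(2,3)])
qed

text \<open>For fixed multipliers the pairs \<open>y\<close>, \<open>X\<close> and \<open>z\<close>,
  \<open>X'\<close> are independent. Left of \<open>m\<close> the minorant has intercept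
  \<open>\<alpha> * m + \<gamma>\<close> and slope \<open>\<beta> - \<alpha>\<close>, right of it
  \<open>\<gamma> - \<alpha> * m\<close> and \<open>\<alpha> + \<beta>\<close>; their negatives are
  the prescribed outer entries.\<close>

lemma sdp_feasible_iff:
  assumes "n \<ge> 1" "0 \<le> a" "m \<in> {a<..<b}"
  shows "(\<exists>y z X X'. sdp_feasible R C \<mu> a b m n \<alpha> \<beta> \<gamma> y z X X') \<longleftrightarrow>
    (\<forall>\<rho>\<in>{a..b}. \<alpha> * \<bar>\<rho> - m\<bar> + \<beta> * \<rho> + \<gamma> \<le> social_benefit R C \<mu> n \<rho>)"
proof -
  have "(\<exists>y z X X'. sdp_feasible R C \<mu> a b m n \<alpha> \<beta> \<gamma> y z X X') \<longleftrightarrow>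
      (\<exists>y X. y \<in> carrier_vec (n + 4) \<and> X \<in> psd_cone (n + 4) \<and>
        y $ 0 = - (\<alpha> * m + \<gamma>) \<and> y $ (n + 3) = - (\<beta> - \<alpha>) \<and>
        coefficient_constraints R C \<mu> n y \<and> interval_constraints n a m y X) \<and>
      (\<exists>z X. z \<in> carrier_vec (n + 4) \<and> X \<in> psd_cone (n + 4) \<and>
        z $ 0 = - (\<gamma> - \<alpha> * m) \<and> z $ (n + 3) = - (\<alpha> + \<beta>) \<and>
        coefficient_constraints R C \<mu> n z \<and> interval_constraints n m b z X)"
    unfolding sdp_feasible_def minus_diff_eq by blast
  also have "\<dots> \<longleftrightarrow> (\<forall>\<rho>\<in>{a..m}. \<alpha> * m + \<gamma> + (\<beta> - \<alpha>) * \<rho> \<le> social_benefit R C \<mu> n \<rho>) \<and>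
      (\<forall>\<rho>\<in>{m..b}. \<gamma> - \<alpha> * m + (\<alpha> + \<beta>) * \<rho> \<le> social_benefit R C \<mu> n \<rho>)"
    using assms by (intro arg_cong2[of _ _ _ _ "(\<and>)"] affine_minorant_certificate_iff) auto
  also have "\<dots> \<longleftrightarrow> (\<forall>\<rho>\<in>{a..m}. \<alpha> * \<bar>\<rho> - m\<bar> + \<beta> * \<rho> + \<gamma> \<le> social_benefit R C \<mu> n \<rho>) \<and>
      (\<forall>\<rho>\<in>{m..b}. \<alpha> * \<bar>\<rho> - m\<bar> + \<beta> * \<rho> + \<gamma> \<le> social_benefit R C \<mu> n \<rho>)"
    by (intro arg_cong2[of _ _ _ _ "(\<and>)"] ball_cong refl) (auto simp: algebra_simps)
  also have "\<dots> \<longleftrightarrow> (\<forall>\<rho>\<in>{a..b}. \<alpha> * \<bar>\<rho> - m\<bar> + \<beta> * \<rho> + \<gamma> \<le> social_benefit R C \<mu> n \<rho>)"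
    unfolding ball_Un[symmetric] using assms(3) by (subst ivl_disj_un_two_touch) auto
  finally show ?thesis .
qed

theorem theorem3p5:
  fixes R C \<mu> a b m d :: real and n :: nat
  assumes "R > 0" "C > 0" "\<mu> > 0"
    and "0 \<le> a" "a < b" "m \<in> {a<..<b}"
    and "d \<in> {0<..<2 * (m - a) * (b - m) / (b - a)}"
    and "n \<ge> 1"
  shows "worst_case_benefit R C \<mu> a b m d n = sdp_value R C \<mu> a b m d n"
proof (rule antisym)
  let ?f = "social_benefit R C \<mu> n"
  have cont: "continuous_on {a..b} ?f"
    using assms(4) by (intro continuous_on_subset[OF continuous_on_social_benefit]) auto
  have sdp: "sdp_value R C \<mu> a b m d n = Sup {ereal (\<alpha> * d + \<beta> * m + \<gamma>) | \<alpha> \<beta> \<gamma>.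
      \<forall>\<rho>\<in>{a..b}. \<alpha> * \<bar>\<rho> - m\<bar> + \<beta> * \<rho> + \<gamma> \<le> ?f \<rho>}"
    unfolding sdp_value_def sdp_feasible_iff[OF assms(8,4,6), symmetric]
    by (intro arg_cong[of _ _ Sup]) blast
  show "sdp_value R C \<mu> a b m d n \<le> worst_case_benefit R C \<mu> a b m d n"
    unfolding sdp worst_case_benefit_def
    by (intro Sup_least INF_greatest) (auto intro!: mad_weak_duality[OF _ cont])
  show "worst_case_benefit R C \<mu> a b m d n \<le> sdp_value R C \<mu> a b m d n"
  proof (rule ccontr)
    assume "\<not> ?thesis"
    \<comment> \<open>Even if one of the two values is infinite, a real \<open>v\<close> lies
      strictly inside the gap; strong duality then gives multipliers with objective above
      \<open>v\<close>.\<close>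
    then obtain v where v: "sdp_value R C \<mu> a b m d n < ereal v"
      "ereal v < worst_case_benefit R C \<mu> a b m d n"
      using ereal_dense2 by (metis not_le)
    have "v < prob_space.expectation P ?f" if "P \<in> mad_ambiguity_set a b m d" for P
      using v(2) INF_lower[OF that, of "\<lambda>P. ereal (prob_space.expectation P ?f)"]
      unfolding worst_case_benefit_def by (metis less_ereal.simps(1) less_le_trans)
    then obtain \<alpha> \<beta> \<gamma> where "\<forall>\<rho>\<in>{a..b}. \<alpha> * \<bar>\<rho> - m\<bar> + \<beta> * \<rho> + \<gamma> \<le> ?f \<rho>"
      "v < \<alpha> * d + \<beta> * m + \<gamma>"
      using mad_strong_duality[OF cont mad_ambiguity_set_nonempty, of m d v] assms(6,7) by auto
    then have "ereal v < sdp_value R C \<mu> a b m d n"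
      unfolding sdp by (intro less_le_trans[OF _ Sup_upper, of _ "ereal (\<alpha> * d + \<beta> * m + \<gamma>)"]) auto
    with v(1) show False by simp
  qed
qed

end
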